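(* Let $p \in \mathbb{R}[x]$ be a one-variable polynomial. Then $T_p$ has the Stieltjes moment property if and only if $p(x)\ge 0$ for all $x\in[0,\infty)$.
   Context: $\mathbb{N}_0$ denotes the set of nonnegative integers and $\mathcal{A}$ the set of all real sequences $\alpha=(\alpha_n)_{n\in\mathbb{N}_0}$. A sequence $\alpha\in\mathcal{A}$ is a Stieltjes moment sequence if there is a nonnegative Borel measure $\mu$ on $\mathbb{R}$ with $\operatorname{supp}(\mu)\subset[0,\infty)$ such that $\alpha_n=\int_{[0,\infty)} x^n\,d\mu$ for all $n\in\mathbb{N}_0$ (all these integrals existing). For a polynomial $p=\sum_i p_i x^i\in\mathbb{R}[x]$, the map $T_p:\mathcal{A}\to\mathcal{A}$ is defined by $T_p(\alpha)=(\tilde\alpha_n)_{n\in\mathbb{N}_0}$ with $\tilde\alpha_n=\sum_i p_i\,\alpha_{n+i}$. $T_p$ has the Stieltjes moment property if, for every Stieltjes moment sequence $\alpha$, the sequence $T_p(\alpha)$ is a Stieltjes moment sequence. *)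

theory Defs
  imports "HOL-Analysis.Analysis" "HOL-Computational_Algebra.Polynomial"
begin

definition measure_support :: "'a::topological_space measure \<Rightarrow> 'a set" where
  "measure_support M = {x. \<forall>U. open U \<longrightarrow> x \<in> U \<longrightarrow> emeasure M U > 0}"

text \<open>Integrability is a separate conjunct because the library integral of a non-integrable
  function is \<open>0\<close>. The zero measure is allowed.\<close>

definition stieltjes_moment_sequence :: "(nat \<Rightarrow> real) \<Rightarrow> bool" where
  "stieltjes_moment_sequence \<alpha> \<longleftrightarrow>
     (\<exists>M :: real measure. sets M = sets borel \<and> measure_support M \<subseteq> {0..} \<and>
        (\<forall>n. set_integrable M {0..} (\<lambda>x. x ^ n) \<and>
             \<alpha> n = set_lebesgue_integral M {0..} (\<lambda>x. x ^ n)))"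

definition T_op :: "real poly \<Rightarrow> (nat \<Rightarrow> real) \<Rightarrow> (nat \<Rightarrow> real)" where
  "T_op p \<alpha> = (\<lambda>n. \<Sum>i\<le>degree p. coeff p i * \<alpha> (n + i))"

definition stieltjes_moment_property :: "((nat \<Rightarrow> real) \<Rightarrow> (nat \<Rightarrow> real)) \<Rightarrow> bool" where
  "stieltjes_moment_property T \<longleftrightarrow>
     (\<forall>\<alpha>. stieltjes_moment_sequence \<alpha> \<longrightarrow> stieltjes_moment_sequence (T \<alpha>))"

end

theory Submission
  imports Defs "HOL-Probability.Giry_Monad"
begin

text \<open>Nonnegativity of \<open>p\<close> lets \<open>p\<close> act as a density on a representing measure. Conversely, the
  point mass at \<open>y\<close> is mapped to a sequence whose zeroth term is \<open>p(y)\<close>, the total mass of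
  a measure.\<close>

text \<open>The half-line \<open>{..<a}\<close> is open, so it is itself a null neighbourhood of
  each of its points.\<close>

lemma measure_support_subset_atLeast:
  fixes M :: "real measure"
  assumes "emeasure M {..<a} = 0"
  shows "measure_support M \<subseteq> {a..}"
proof
  fix x assume "x \<in> measure_support M"
  then have "x \<in> {..<a} \<Longrightarrow> emeasure M {..<a} > 0"
    unfolding measure_support_def using open_lessThan by blast
  with assms show "x \<in> {a..}"
    by force
qed

lemma stieltjes_moment_sequence_power:
  fixes y :: real
  assumes "y \<ge> 0"
  shows "stieltjes_moment_sequence (\<lambda>n. y ^ n)"
  unfolding stieltjes_moment_sequence_def
proof (intro exI[of _ "return borel y"] conjI allI)
  let ?M = "return borel y :: real measure"
  show "sets ?M = sets borel"
    by simp
  show "measure_support ?M \<subseteq> {0..}"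
    using assms by (intro measure_support_subset_atLeast) (simp add: indicator_def)
  fix n
  \<comment> \<open>Integrating against the point mass evaluates at \<open>y\<close>, where the
    indicator is 1 because \<open>y \<ge> 0\<close>.\<close>
  have "has_bochner_integral ?M (\<lambda>x. indicator {0..} x *\<^sub>R x ^ n) (y ^ n)"
    using assms
    by (auto simp: has_bochner_integral_iff integral_return integrable_iff_bounded nn_integral_return)
  then show "set_integrable ?M {0..} (\<lambda>x. x ^ n)"
    and "y ^ n = set_lebesgue_integral ?M {0..} (\<lambda>x. x ^ n)"
    by (simp_all add: has_bochner_integral_iff set_integrable_def set_lebesgue_integral_def)
qed

text \<open>Geometric sequences are eigenvectors of every \<open>T_op p\<close>. At
  \<open>n = 0\<close> the eigenvalue itself remains, even for \<open>y = 0\<close>, since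
  \<open>0 ^ 0 = 1\<close>.\<close>

lemma T_op_power: "T_op p (\<lambda>n. y ^ n) n = poly p y * y ^ n"
  by (simp add: T_op_def poly_altdef power_add sum_distrib_left mult_ac)

lemma stieltjes_moment_sequence_T_op:
  assumes nonneg: "\<forall>x\<in>{0..}. poly p x \<ge> 0" and "stieltjes_moment_sequence \<alpha>"
  shows "stieltjes_moment_sequence (T_op p \<alpha>)"
proof -
  obtain M :: "real measure" where sets_M [measurable_cong]: "sets M = sets borel"
    and int: "\<And>n. set_integrable M {0..} (\<lambda>x. x ^ n)"
    and eq: "\<And>n. \<alpha> n = set_lebesgue_integral M {0..} (\<lambda>x. x ^ n)"
    using assms(2) unfolding stieltjes_moment_sequence_def by blast
  \<comment> \<open>The polynomial may be negative on the negative axis; the indicator makes the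
    density nonnegative everywhere and confines the new measure to \<open>{0..}\<close>.\<close>
  define f where "f = (\<lambda>x. indicator {0..} x * poly p x)"
  have f_meas [measurable]: "f \<in> borel_measurable borel"
    unfolding f_def poly_altdef by measurable
  have f_nonneg: "f x \<ge> 0" for x
    using nonneg by (auto simp: f_def indicator_def)
  let ?N = "density M f"
  have moment: "has_bochner_integral ?N (\<lambda>x. indicator {0..} x *\<^sub>R x ^ n) (T_op p \<alpha> n)" for n
  proof (rule has_bochner_integral_density)
    \<comment> \<open>Expanding \<open>p\<close> turns the n-th moment of \<open>?N\<close> into a
      finite combination of the moments of \<open>M\<close> of orders \<open>n + i\<close>, which
      gives integrability and value together.\<close>
    have "has_bochner_integral M
        (\<lambda>x. \<Sum>i\<le>degree p. coeff p i * (indicator {0..} x *\<^sub>R x ^ (n + i))) (T_op p \<alpha> n)"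
      unfolding T_op_def
      using int eq
      by (intro has_bochner_integral_sum has_bochner_integral_mult_right)
         (simp_all add: has_bochner_integral_iff set_integrable_def set_lebesgue_integral_def)
    also have "(\<lambda>x. \<Sum>i\<le>degree p. coeff p i * (indicator {0..} x *\<^sub>R x ^ (n + i)))
        = (\<lambda>x. f x *\<^sub>R (indicator {0..} x *\<^sub>R x ^ n))"
      by (auto simp: f_def poly_altdef power_add sum_distrib_left indicator_def mult_ac)
    finally show "has_bochner_integral M (\<lambda>x. f x *\<^sub>R (indicator {0..} x *\<^sub>R x ^ n)) (T_op p \<alpha> n)" .
  qed (use f_nonneg in \<open>auto simp: f_meas\<close>)
  \<comment> \<open>Since \<open>f\<close> vanishes on the negative axis, \<open>?N\<close> has no
    mass there.\<close>
  have "emeasure ?N {..<0} = (\<integral>\<^sup>+ x. ennreal (f x) * indicator {..<0} x \<partial>M)"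
    by (simp add: emeasure_density sets_M)
  also have "\<dots> = (\<integral>\<^sup>+ x. 0 \<partial>M)"
    by (rule nn_integral_cong) (auto simp: f_def indicator_def)
  finally have "measure_support ?N \<subseteq> {0..}"
    by (intro measure_support_subset_atLeast) simp
  then show ?thesis
    unfolding stieltjes_moment_sequence_def
    using moment
    by (intro exI[of _ ?N])
       (auto simp: sets_M has_bochner_integral_iff set_integrable_def set_lebesgue_integral_def)
qed

theorem theorem2p4:
  fixes p :: "real poly"
  shows "stieltjes_moment_property (T_op p) \<longleftrightarrow> (\<forall>x\<in>{0..}. poly p x \<ge> 0)"
proof
  assume T: "stieltjes_moment_property (T_op p)"
  show "\<forall>x\<in>{0..}. poly p x \<ge> 0"
  proof
    fix y :: real assume "y \<in> {0..}"
    then have "stieltjes_moment_sequence (T_op p (\<lambda>n. y ^ n))"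
      using T stieltjes_moment_sequence_power unfolding stieltjes_moment_property_def by auto
    then obtain M :: "real measure"
      where "T_op p (\<lambda>n. y ^ n) 0 = set_lebesgue_integral M {0..} (\<lambda>x. x ^ 0)"
      unfolding stieltjes_moment_sequence_def by blast
    \<comment> \<open>The left side is \<open>poly p y\<close>; the right side integrates the
      indicator of \<open>{0..}\<close>, so it is nonnegative.\<close>
    then show "poly p y \<ge> 0"
      by (simp add: T_op_power set_lebesgue_integral_def)
  qed
next
  assume "\<forall>x\<in>{0..}. poly p x \<ge> 0"
  then show "stieltjes_moment_property (T_op p)"
    using stieltjes_moment_sequence_T_op unfolding stieltjes_moment_property_def by blast
qed

end
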